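(* Let $X=\begin{bmatrix}A&B\\C&D\end{bmatrix}\in\mathbb{R}^{n\times n}$, where $A\in\mathbb{R}^{m\times m}$ and $D\in\mathbb{R}^{(n-m)\times(n-m)}$. Let $A=U_A\Lambda_AV_A^*$ and $D=U_D\Lambda_DV_D^*$ be singular value decompositions of $A$ and $D$. Let $[U_A\ \overline{U_A}]$ and $[V_A\ \overline{V_A}]$ be unitary (real orthogonal) matrices in $\mathbb{R}^{m\times m}$, and let $[U_D\ \overline{U_D}]$ and $[V_D\ \overline{V_D}]$ be unitary (real orthogonal) matrices in $\mathbb{R}^{(n-m)\times(n-m)}$. Define $$E=\begin{bmatrix}U_A&\overline{U_A}&\mathbf{0}&\mathbf{0}\\\mathbf{0}&\mathbf{0}&U_D&\overline{U_D}\end{bmatrix}^*\begin{bmatrix}A&B\\C&D\end{bmatrix}\begin{bmatrix}V_A&\overline{V_A}&\mathbf{0}&\mathbf{0}\\\mathbf{0}&\mathbf{0}&V_D&\overline{V_D}\end{bmatrix}.$$ Then $$\left\|\begin{bmatrix}A&B\\C&D\end{bmatrix}\right\|_*=\left\|\begin{bmatrix}A&\mathbf{0}\\\mathbf{0}&D\end{bmatrix}\right\|_*$$ if and only if the following conditions hold simultaneously: (1) the row space of $X$ is a subspace of the row space of $\begin{bmatrix}V_A&\mathbf{0}\\\mathbf{0}&V_D\end{bmatrix}^*$; (2) the column space of $X$ is a subspace of the column space of $\begin{bmatrix}U_A&\mathbf{0}\\\mathbf{0}&U_D\end{bmatrix}$; (3) $E$ is a symmetric positive semidefinite matrix.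
   Context: $\|\cdot\|_*$ is the nuclear norm (sum of singular values) and $^*$ the conjugate transpose (equal to the transpose for real matrices). Singular value decompositions are compact: for a real matrix $M$ of rank $k$, $M=U_M\Lambda_MV_M^*$ where $U_M$ and $V_M$ are real with $k$ orthonormal columns and $\Lambda_M\in\mathbb{R}^{k\times k}$ is diagonal with the positive singular values of $M$ on its diagonal. The matrices with overlines complete the corresponding orthonormal columns to an orthonormal basis (and may have no columns). *)

theory Defs
  imports "Jordan_Normal_Form.DL_Rank" "Jordan_Normal_Form.Char_Poly"
begin

(* The eigenvalues of the transpose of M times M are taken with algebraic multiplicity, so an
   r by c matrix gets c singular values, zeros included. *)
definition singular_values :: "real mat \<Rightarrow> real multiset" where
  "singular_values M = image_mset sqrt (proots (char_poly (M\<^sup>T * M)))"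

definition nuclear_norm :: "real mat \<Rightarrow> real" where
  "nuclear_norm M = \<Sum>\<^sub># (singular_values M)"

definition orthonormal_cols :: "real mat \<Rightarrow> bool" where
  "orthonormal_cols U \<longleftrightarrow> U\<^sup>T * U = 1\<^sub>m (dim_col U)"

(* The library's orthogonal_mat does not require normalised columns. *)
definition real_unitary :: "real mat \<Rightarrow> bool" where
  "real_unitary U \<longleftrightarrow> square_mat U \<and> U\<^sup>T * U = 1\<^sub>m (dim_row U) \<and> U * U\<^sup>T = 1\<^sub>m (dim_row U)"

definition compact_svd :: "real mat \<Rightarrow> real mat \<Rightarrow> real mat \<Rightarrow> real mat \<Rightarrow> bool" where
  "compact_svd M U L V \<longleftrightarrow>
    (let k = vec_space.rank (dim_row M) M in
      U \<in> carrier_mat (dim_row M) k \<and> orthonormal_cols U \<and>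
      V \<in> carrier_mat (dim_col M) k \<and> orthonormal_cols V \<and>
      L \<in> carrier_mat k k \<and> diagonal_mat L \<and>
      mset (diag_mat L) = filter_mset (\<lambda>s. 0 < s) (singular_values M) \<and>
      M = U * L * V\<^sup>T)"

definition append_cols :: "'a :: zero mat \<Rightarrow> 'a mat \<Rightarrow> 'a mat" where
  "append_cols M N = four_block_mat M N (0\<^sub>m 0 (dim_col M)) (0\<^sub>m 0 (dim_col N))"

definition sym_psd :: "real mat \<Rightarrow> bool" where
  "sym_psd M \<longleftrightarrow> square_mat M \<and> M\<^sup>T = M \<and>
    (\<forall>x \<in> carrier_vec (dim_row M). 0 \<le> x \<bullet> (M *\<^sub>v x))"

end

theory Submission
  imports Defs "Jordan_Normal_Form.Spectral_Radius"
begin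

text \<open>
  The theorem reduces to one fact about a square real matrix \<open>E\<close>: its nuclear norm equals its
  trace if and only if \<open>E\<close> is symmetric positive semidefinite
  (\<open>nuclear_norm_eq_trace_if_sym_psd\<close> and \<open>sym_psd_if_nuclear_norm_eq_trace\<close>).
  The \<open>if\<close> part holds because singular values of a positive semidefinite matrix are its eigenvalues.
  The \<open>only if\<close> part is the equality case of Cauchy--Schwarz, applied to each pair \<open>q\<close>, \<open>E q\<close> with
  \<open>q\<close> in an orthonormal eigenbasis of \<open>E\<^sup>T E\<close>. Both parts rest on the spectral theorem for real
  symmetric matrices (\<open>real_spectral_theorem\<close>).

  The nuclear norm does not change under multiplication by orthogonal matrices on either side
  (\<open>nuclear_norm_unitary_invariant\<close>), so \<open>X\<close> and \<open>E\<close> have the same nuclear norm. The same change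
  of bases turns the block diagonal of \<open>X\<close> into a diagonal matrix with nonnegative entries
  (\<open>completed_svd_diagonalizes\<close>). This matrix has the same diagonal as \<open>E\<close>, hence
  the nuclear norm of the block diagonal of \<open>X\<close> is the trace of \<open>E\<close>. The equality of
  nuclear norms is therefore equivalent to \<open>E\<close> being symmetric positive semidefinite.

  The row space and column space conditions follow from the semidefiniteness of \<open>E\<close>. At the indices of the completing basis vectors the
  diagonal entries of \<open>E\<close> are zero, and in a positive semidefinite matrix a zero diagonal entry
  forces the whole row and column to vanish (\<open>sym_psd_zero_diag_imp_zero_row\<close>). So when
  \<open>X\<close> is recovered from \<open>E\<close>, only the original singular vectors contribute to its column space
  and to its row space (\<open>col_space_block_subset\<close>).
\<close>

section \<open>Orthogonal matrices and block-diagonal matrices\<close>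

lemma real_unitaryI:
  assumes "U \<in> carrier_mat n n" and "U\<^sup>T * U = 1\<^sub>m n" and "U * U\<^sup>T = 1\<^sub>m n"
  shows "real_unitary U"
  using assms unfolding real_unitary_def by auto

lemma real_unitaryD:
  assumes "real_unitary U" and "U \<in> carrier_mat n n"
  shows "U\<^sup>T * U = 1\<^sub>m n" and "U * U\<^sup>T = 1\<^sub>m n"
  using assms unfolding real_unitary_def by auto

lemma real_unitary_mult:
  assumes U: "U \<in> carrier_mat n n" "real_unitary U" and V: "V \<in> carrier_mat n n" "real_unitary V"
  shows "real_unitary (U * V)"
proof (rule real_unitaryI[of _ n])
  note c = U(1) V(1)
  have "(U * V)\<^sup>T * (U * V) = V\<^sup>T * (U\<^sup>T * U) * V"
    using c by (simp add: transpose_mult[OF c] assoc_mult_mat[of _ n n _ n _ n] mult_carrier_mat[of _ n n _ n])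
  then show "(U * V)\<^sup>T * (U * V) = 1\<^sub>m n"
    using c by (simp add: real_unitaryD[OF U(2,1)] real_unitaryD[OF V(2,1)])
  have "(U * V) * (U * V)\<^sup>T = U * (V * V\<^sup>T) * U\<^sup>T"
    using c by (simp add: transpose_mult[OF c] assoc_mult_mat[of _ n n _ n _ n] mult_carrier_mat[of _ n n _ n])
  then show "(U * V) * (U * V)\<^sup>T = 1\<^sub>m n"
    using c by (simp add: real_unitaryD[OF U(2,1)] real_unitaryD[OF V(2,1)])
qed (use U V in auto)

lemma mult_block_diag:
  fixes P R :: "'a :: semiring_1 mat"
  assumes "P \<in> carrier_mat a a'" and "P' \<in> carrier_mat a' a''"
    and "R \<in> carrier_mat b b'" and "R' \<in> carrier_mat b' b''"
  shows "four_block_mat P (0\<^sub>m a b') (0\<^sub>m b a') R * four_block_mat P' (0\<^sub>m a' b'') (0\<^sub>m b' a'') R'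
    = four_block_mat (P * P') (0\<^sub>m a b'') (0\<^sub>m b a'') (R * R')"
proof -
  have "P * P' \<in> carrier_mat a a''" "R * R' \<in> carrier_mat b b''" using assms by auto
  then show ?thesis
    using assms right_mult_zero_mat[OF assms(1)] right_mult_zero_mat[OF assms(3)]
      left_mult_zero_mat[OF assms(2)] left_mult_zero_mat[OF assms(4)]
    by (subst mult_four_block_mat[of _ a a' _ b' _ b _ _ a'' _ b'']) auto
qed

lemma transpose_block_diag:
  assumes "P \<in> carrier_mat a a'" and "R \<in> carrier_mat b b'"
  shows "(four_block_mat P (0\<^sub>m a b') (0\<^sub>m b a') R)\<^sup>T
    = four_block_mat (P\<^sup>T) (0\<^sub>m a' b) (0\<^sub>m b' a) (R\<^sup>T)"
  using assms by (subst transpose_four_block_mat[of _ a a' _ b' _ b]) auto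

lemma mat_diag_block_diag:
  "four_block_mat (mat_diag a p) (0\<^sub>m a b) (0\<^sub>m b a) (mat_diag b q)
    = mat_diag (a + b) (\<lambda>i. if i < a then p i else q (i - a))"
  by (rule eq_matI) (auto simp: mat_diag_def)

lemma real_unitary_block_diag:
  assumes U: "U \<in> carrier_mat a a" "real_unitary U" and V: "V \<in> carrier_mat b b" "real_unitary V"
  shows "real_unitary (four_block_mat U (0\<^sub>m a b) (0\<^sub>m b a) V)"
  using U(1) V(1) real_unitaryD[OF U(2,1)] real_unitaryD[OF V(2,1)]
  by (intro real_unitaryI[of _ "a + b"])
    (auto simp: transpose_block_diag[of _ a a _ b b] mult_block_diag[of _ a a _ a _ b b _ b])

section \<open>The real spectral theorem\<close>

lemma scalar_prod_self_eq_sum_squares: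
  fixes v :: "real vec"
  shows "v \<bullet> v = (\<Sum>i<dim_vec v. (v $ i)\<^sup>2)"
  by (simp add: scalar_prod_def lessThan_atLeast0 power2_eq_square)

lemma scalar_prod_self_nonneg: "0 \<le> v \<bullet> (v :: real vec)"
  by (simp add: scalar_prod_self_eq_sum_squares sum_nonneg)

lemma scalar_prod_self_eq_0_iff:
  fixes v :: "real vec"
  assumes "v \<in> carrier_vec n"
  shows "v \<bullet> v = 0 \<longleftrightarrow> v = 0\<^sub>v n"
proof
  assume "v \<bullet> v = 0"
  then have "\<forall>i<n. v $ i = 0"
    using assms by (simp add: scalar_prod_self_eq_sum_squares sum_nonneg_eq_0_iff)
  then show "v = 0\<^sub>v n" using assms by (intro eq_vecI) auto
qed simp

text \<open>
  The reflection exchanging the two unit vectors \<open>v\<close> and \<open>e\<^sub>0\<close> provides an orthogonal matrix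
  with a prescribed first column without a Gram--Schmidt completion. With
  \<open>w = v - e\<^sub>0\<close> it is \<open>I - 2 w w\<^sup>T / (w \<bullet> w)\<close>, and \<open>w \<bullet> w = 2 - 2 v\<^sub>0\<close> because \<open>v\<close> is a unit vector.
\<close>
lemma real_unitary_with_first_column:
  fixes v :: "real vec"
  assumes v: "v \<in> carrier_vec n" and n: "0 < n" and unit: "v \<bullet> v = 1"
  obtains H where "H \<in> carrier_mat n n" and "real_unitary H" and "H *\<^sub>v unit_vec n 0 = v"
proof (cases "v = unit_vec n 0")
  case True
  then show ?thesis
    by (intro that[of "1\<^sub>m n"] real_unitaryI[of _ n]) auto
next
  case False
  define w where "w i = v $ i - (if i = 0 then 1 else 0)" for i
  define s where "s = (\<Sum>i<n. w i * w i)"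
  have vv: "(\<Sum>i<n. v $ i * v $ i) = 1"
    using unit v by (simp add: scalar_prod_def lessThan_atLeast0)
  have "s = (\<Sum>i<n. v $ i * v $ i + (if i = 0 then 1 - 2 * v $ 0 else 0))"
    unfolding s_def w_def by (intro sum.cong) (auto simp: algebra_simps)
  also have "\<dots> = 2 - 2 * v $ 0"
    using n by (simp add: sum.distrib vv)
  finally have s: "s = 2 - 2 * v $ 0" .
  have "s \<noteq> 0"
  proof
    assume "s = 0"
    then have "\<forall>i<n. w i = 0"
      unfolding s_def by (subst (asm) sum_nonneg_eq_0_iff) auto
    then have "v = unit_vec n 0"
      using v n by (intro eq_vecI) (auto simp: w_def unit_vec_def split: if_splits)
    with False show False by simp
  qed
  define H where "H = mat n n (\<lambda>(i,j). (if i = j then 1 else 0) - 2 / s * (w i * w j))"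
  have H: "H \<in> carrier_mat n n" and Ht: "H\<^sup>T = H"
    unfolding H_def by (auto intro!: eq_matI)
  have HH: "H * H = 1\<^sub>m n"
  proof (rule eq_matI)
    fix i j assume "i < dim_row (1\<^sub>m n :: real mat)" "j < dim_col (1\<^sub>m n :: real mat)"
    then have ij: "i < n" "j < n" by auto
    have "(H * H) $$ (i,j) = (\<Sum>k<n. ((if i = k then 1 else 0) - 2 / s * (w i * w k))
        * ((if k = j then 1 else 0) - 2 / s * (w k * w j)))"
      using ij by (simp add: H_def scalar_prod_def lessThan_atLeast0)
    also have "\<dots> = (\<Sum>k<n. (if k = i then (if i = j then 1 else 0) - 2 / s * (w i * w j) else 0)
        - (if k = j then 2 / s * (w i * w j) else 0) + 4 / s\<^sup>2 * (w i * w j) * (w k * w k))"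
      by (intro sum.cong) (auto simp: algebra_simps power2_eq_square)
    also have "\<dots> = (if i = j then 1 else 0) - 4 / s * (w i * w j) + 4 / s\<^sup>2 * (w i * w j) * s"
      unfolding s_def sum_distrib_left using ij by (simp add: sum.distrib sum_subtractf)
    also have "\<dots> = (if i = j then 1 else 0)"
      using \<open>s \<noteq> 0\<close> by (simp add: power2_eq_square)
    finally show "(H * H) $$ (i,j) = 1\<^sub>m n $$ (i,j)" using ij by simp
  qed (use H in auto)
  have "H *\<^sub>v unit_vec n 0 = v"
  proof (rule eq_vecI)
    fix i assume "i < dim_vec v"
    then have i: "i < n" using v by simp
    have "(H *\<^sub>v unit_vec n 0) $ i = H $$ (i, 0)"
      using i n H by (simp add: scalar_prod_right_unit)
    also have "\<dots> = (if i = 0 then 1 else 0) - 2 / s * (w i * w 0)"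
      using i n by (simp add: H_def)
    also have "2 / s * (w i * w 0) = - w i"
    proof -
      have "w 0 = - s / 2" by (simp add: w_def s)
      then show ?thesis using \<open>s \<noteq> 0\<close> by simp
    qed
    finally show "(H *\<^sub>v unit_vec n 0) $ i = v $ i" by (simp add: w_def)
  qed (use H v in auto)
  then show ?thesis
    using that[OF H real_unitaryI[OF H]] HH Ht by simp
qed

text \<open>
  Algebraic closedness of the complex numbers gives an eigenvector \<open>x + i y\<close> with some complex
  eigenvalue \<open>z\<close>. Comparing real and imaginary parts yields \<open>A x = Re z x - Im z y\<close> and
  \<open>A y = Re z y + Im z x\<close>, so the symmetry \<open>A y \<bullet> x = y \<bullet> A x\<close> becomes
  \<open>Im z (x \<bullet> x + y \<bullet> y) = 0\<close>. Hence \<open>z\<close> is real, and whichever of \<open>x\<close> and \<open>y\<close> is nonzero is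
  a real eigenvector.
\<close>
lemma symmetric_real_eigenvector:
  fixes A :: "real mat"
  assumes A: "A \<in> carrier_mat n n" and sym: "A\<^sup>T = A" and n: "0 < n"
  obtains v l where "v \<in> carrier_vec n" and "v \<bullet> v = 1" and "A *\<^sub>v v = l \<cdot>\<^sub>v v"
proof -
  define Ac where "Ac = map_mat complex_of_real A"
  have Ac: "Ac \<in> carrier_mat n n" using A by (simp add: Ac_def)
  from spectrum_non_empty[OF Ac n] obtain z u where ev: "eigenvector Ac u z"
    unfolding spectrum_def eigenvalue_def by auto
  then have u: "u \<in> carrier_vec n" "u \<noteq> 0\<^sub>v n" and Au: "Ac *\<^sub>v u = z \<cdot>\<^sub>v u"
    using Ac unfolding eigenvector_def by auto
  define x where "x = map_vec Re u"
  define y where "y = map_vec Im u"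
  have x: "x \<in> carrier_vec n" and y: "y \<in> carrier_vec n"
    using u by (auto simp: x_def y_def)
  have comp: "(\<Sum>j<n. complex_of_real (A $$ (i,j)) * u $ j) = z * u $ i" if "i < n" for i
  proof -
    have "(Ac *\<^sub>v u) $ i = (z \<cdot>\<^sub>v u) $ i" using Au by simp
    then show ?thesis
      using that A u by (simp add: Ac_def scalar_prod_def lessThan_atLeast0)
  qed
  have Ax: "A *\<^sub>v x = Re z \<cdot>\<^sub>v x - Im z \<cdot>\<^sub>v y"
  proof (rule eq_vecI)
    fix i assume "i < dim_vec (Re z \<cdot>\<^sub>v x - Im z \<cdot>\<^sub>v y)"
    then have i: "i < n" using x y by simp
    show "(A *\<^sub>v x) $ i = (Re z \<cdot>\<^sub>v x - Im z \<cdot>\<^sub>v y) $ i"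
      using arg_cong[OF comp[OF i], of Re] i A u x y
      by (simp add: scalar_prod_def lessThan_atLeast0 x_def y_def)
  qed (use A x y in auto)
  have Ay: "A *\<^sub>v y = Re z \<cdot>\<^sub>v y + Im z \<cdot>\<^sub>v x"
  proof (rule eq_vecI)
    fix i assume "i < dim_vec (Re z \<cdot>\<^sub>v y + Im z \<cdot>\<^sub>v x)"
    then have i: "i < n" using x y by simp
    show "(A *\<^sub>v y) $ i = (Re z \<cdot>\<^sub>v y + Im z \<cdot>\<^sub>v x) $ i"
      using arg_cong[OF comp[OF i], of Im] i A u x y
      by (simp add: scalar_prod_def lessThan_atLeast0 x_def y_def)
  qed (use A x y in auto)
  have nz: "x \<noteq> 0\<^sub>v n \<or> y \<noteq> 0\<^sub>v n"
  proof (rule ccontr)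
    assume "\<not> ?thesis"
    then have 0: "x = 0\<^sub>v n" "y = 0\<^sub>v n" by auto
    have "u $ i = 0" if i: "i < n" for i
    proof -
      have "Re (u $ i) = x $ i" "Im (u $ i) = y $ i" using i u by (auto simp: x_def y_def)
      then show ?thesis using i by (simp add: 0 complex_eq_iff)
    qed
    then have "u = 0\<^sub>v n" using u by (intro eq_vecI) auto
    with u show False by simp
  qed
  have pos: "0 < w \<bullet> w" if "w \<in> carrier_vec n" "w \<noteq> 0\<^sub>v n" for w :: "real vec"
    using that scalar_prod_self_nonneg[of w] scalar_prod_self_eq_0_iff[of w n] by simp
  have nn: "0 \<le> x \<bullet> x" "0 \<le> y \<bullet> y" by (rule scalar_prod_self_nonneg)+
  have "(A *\<^sub>v y) \<bullet> x = y \<bullet> (A *\<^sub>v x)"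
    using transpose_vec_mult_scalar[OF A x y] sym by simp
  then have "Im z * (x \<bullet> x + y \<bullet> y) = 0"
    unfolding Ax Ay using x y
    by (simp add: add_scalar_prod_distrib[of _ n] scalar_prod_minus_distrib[of _ n] algebra_simps)
  moreover have "x \<bullet> x + y \<bullet> y > 0"
    using nz pos[OF x] pos[OF y] nn by auto
  ultimately have "Im z = 0" by simp
  with Ax Ay have Axy: "A *\<^sub>v x = Re z \<cdot>\<^sub>v x" "A *\<^sub>v y = Re z \<cdot>\<^sub>v y"
    using x y by (auto intro!: eq_vecI)
  from nz Axy x y obtain w where w: "w \<in> carrier_vec n" "w \<noteq> 0\<^sub>v n" "A *\<^sub>v w = Re z \<cdot>\<^sub>v w" by auto
  define c where "c = 1 / sqrt (w \<bullet> w)"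
  show ?thesis
  proof (rule that[of "c \<cdot>\<^sub>v w" "Re z"])
    show "(c \<cdot>\<^sub>v w) \<bullet> (c \<cdot>\<^sub>v w) = 1"
      using w pos[OF w(1,2)] by (simp add: c_def)
    show "A *\<^sub>v (c \<cdot>\<^sub>v w) = Re z \<cdot>\<^sub>v (c \<cdot>\<^sub>v w)"
      using w A by (simp add: mult_mat_vec[of _ n n] smult_smult_assoc mult.commute)
  qed (use w in auto)
qed

text \<open>
  Induction on the size by deflation: if \<open>H\<close> is orthogonal and its first column is a unit
  eigenvector, then the first column of \<open>H\<^sup>T A H\<close> is a multiple of \<open>e\<^sub>0\<close>. By symmetry so is the
  first row, and the remaining block is symmetric and one size smaller.
\<close>
lemma real_spectral_theorem:
  fixes A :: "real mat"
  assumes "A \<in> carrier_mat n n" and "A\<^sup>T = A"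
  shows "\<exists>Q d. Q \<in> carrier_mat n n \<and> real_unitary Q \<and> A = Q * mat_diag n d * Q\<^sup>T"
  using assms
proof (induction n arbitrary: A)
  case 0
  show ?case
    using 0 by (intro exI[of _ "1\<^sub>m 0"] exI[of _ "\<lambda>_. 0"])
      (auto intro!: real_unitaryI[of _ 0] eq_matI)
next
  case (Suc n)
  note A = Suc.prems(1) and sym = Suc.prems(2)
  obtain v l where v: "v \<in> carrier_vec (Suc n)" "v \<bullet> v = 1" and Av: "A *\<^sub>v v = l \<cdot>\<^sub>v v"
    using symmetric_real_eigenvector[OF A sym] by blast
  obtain H where H: "H \<in> carrier_mat (Suc n) (Suc n)" "real_unitary H"
    and Hv: "H *\<^sub>v unit_vec (Suc n) 0 = v"
    using real_unitary_with_first_column[OF v(1) _ v(2)] by blast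
  note HH = real_unitaryD[OF H(2,1)]
  define B where "B = H\<^sup>T * A * H"
  have B: "B \<in> carrier_mat (Suc n) (Suc n)" using A H by (auto simp: B_def)
  have Bt: "B\<^sup>T = B"
    unfolding B_def using A H
    by (simp add: transpose_mult[of _ "Suc n" "Suc n" _ "Suc n"] sym
      assoc_mult_mat[of _ "Suc n" "Suc n" _ "Suc n" _ "Suc n"]
      mult_carrier_mat[of _ "Suc n" "Suc n" _ "Suc n"])
  have "H\<^sup>T *\<^sub>v v = (H\<^sup>T * H) *\<^sub>v unit_vec (Suc n) 0"
    using H Hv by simp
  then have Htv: "H\<^sup>T *\<^sub>v v = unit_vec (Suc n) 0" using HH by simp
  have "B *\<^sub>v unit_vec (Suc n) 0 = H\<^sup>T *\<^sub>v (A *\<^sub>v (H *\<^sub>v unit_vec (Suc n) 0))"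
    unfolding B_def using A H by (simp add: assoc_mult_mat_vec[of _ "Suc n" "Suc n" _ "Suc n"])
  also have "\<dots> = l \<cdot>\<^sub>v unit_vec (Suc n) 0"
    using H v Av by (simp add: Hv mult_mat_vec[of _ "Suc n" "Suc n"] Htv)
  finally have Be: "B *\<^sub>v unit_vec (Suc n) 0 = l \<cdot>\<^sub>v unit_vec (Suc n) 0" .
  have B0: "B $$ (i, 0) = (if i = 0 then l else 0)" if i: "i < Suc n" for i
  proof -
    have "B $$ (i, 0) = (B *\<^sub>v unit_vec (Suc n) 0) $ i"
      using i B by (simp add: scalar_prod_right_unit)
    then show ?thesis unfolding Be using i by (simp add: unit_vec_def)
  qed
  have B0': "B $$ (0, j) = (if j = 0 then l else 0)" if j: "j < Suc n" for j
    using B0[OF j] arg_cong[OF Bt, of "\<lambda>M. M $$ (j, 0)"] B j by simp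
  define C where "C = mat n n (\<lambda>(i,j). B $$ (Suc i, Suc j))"
  have C: "C \<in> carrier_mat n n" by (simp add: C_def)
  have "C\<^sup>T = C"
  proof (rule eq_matI)
    fix i j assume "i < dim_row C" "j < dim_col C"
    then show "C\<^sup>T $$ (i,j) = C $$ (i,j)"
      using arg_cong[OF Bt, of "\<lambda>M. M $$ (Suc i, Suc j)"] B by (simp add: C_def)
  qed (auto simp: C_def)
  from Suc.IH[OF C this] obtain R d where R: "R \<in> carrier_mat n n" "real_unitary R"
    and Ceq: "C = R * mat_diag n d * R\<^sup>T" by auto
  define K where "K = four_block_mat (1\<^sub>m 1) (0\<^sub>m 1 n) (0\<^sub>m n 1) R"
  have K: "K \<in> carrier_mat (Suc n) (Suc n)"
    using four_block_carrier_mat[OF one_carrier_mat[of 1] R(1)] by (simp add: K_def)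
  have Ku: "real_unitary K"
    unfolding K_def by (rule real_unitary_block_diag[OF _ _ R]) (auto intro!: real_unitaryI[of _ 1])
  define e where "e i = (if i < 1 then l else d (i - 1))" for i
  have De: "mat_diag (Suc n) e
      = four_block_mat (mat_diag 1 (\<lambda>_. l)) (0\<^sub>m 1 n) (0\<^sub>m n 1) (mat_diag n d)"
    unfolding mat_diag_block_diag e_def by simp
  have RD: "R * mat_diag n d \<in> carrier_mat n n" using R by simp
  have "B = four_block_mat (mat_diag 1 (\<lambda>_. l)) (0\<^sub>m 1 n) (0\<^sub>m n 1) C"
  proof (rule eq_matI, goal_cases)
    case (1 i j)
    then show ?case
      by (cases i; cases j) (auto simp: B0 B0' C_def mat_diag_def)
  qed (use B C in \<open>auto simp: mat_diag_def\<close>)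
  also have "\<dots> = four_block_mat (1\<^sub>m 1 * mat_diag 1 (\<lambda>_. l) * (1\<^sub>m 1)\<^sup>T) (0\<^sub>m 1 n) (0\<^sub>m n 1)
      (R * mat_diag n d * R\<^sup>T)"
    using left_mult_one_mat[of "mat_diag 1 (\<lambda>_. l)" 1 1]
      right_mult_one_mat[of "mat_diag 1 (\<lambda>_. l)" 1 1] by (simp add: Ceq)
  also have "\<dots> = K * mat_diag (Suc n) e * K\<^sup>T"
    unfolding De K_def transpose_block_diag[OF one_carrier_mat R(1)]
      mult_block_diag[OF one_carrier_mat mat_diag_dim R(1) mat_diag_dim]
    by (rule mult_block_diag[symmetric, OF mult_carrier_mat[OF one_carrier_mat mat_diag_dim] _ RD])
      (use R in auto)
  finally have Beq: "B = K * mat_diag (Suc n) e * K\<^sup>T" .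
  have "A = (H * H\<^sup>T) * A * (H * H\<^sup>T)" using A HH by simp
  also have "\<dots> = H * B * H\<^sup>T" unfolding B_def using A H
    by (simp add: assoc_mult_mat[of _ "Suc n" "Suc n" _ "Suc n" _ "Suc n"]
      mult_carrier_mat[of _ "Suc n" "Suc n" _ "Suc n"])
  also have "\<dots> = (H * K) * mat_diag (Suc n) e * (H * K)\<^sup>T"
    unfolding Beq using A H K by (simp add: transpose_mult[of _ "Suc n" "Suc n" _ "Suc n"]
      assoc_mult_mat[of _ "Suc n" "Suc n" _ "Suc n" _ "Suc n"]
      mult_carrier_mat[of _ "Suc n" "Suc n" _ "Suc n"])
  finally have "A = (H * K) * mat_diag (Suc n) e * (H * K)\<^sup>T" .
  moreover have "H * K \<in> carrier_mat (Suc n) (Suc n)" using H K by simp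
  ultimately show ?case using real_unitary_mult[OF H K Ku] by blast
qed

section \<open>The nuclear norm and the trace\<close>

definition mat_trace :: "real mat \<Rightarrow> real" where
  "mat_trace M = (\<Sum>i<dim_row M. M $$ (i,i))"

lemma mat_trace_mult_commute:
  assumes A: "A \<in> carrier_mat n m" and B: "B \<in> carrier_mat m n"
  shows "mat_trace (A * B) = mat_trace (B * A)"
proof -
  have "mat_trace (A * B) = (\<Sum>i<n. \<Sum>k<m. A $$ (i,k) * B $$ (k,i))"
    using A B by (simp add: mat_trace_def scalar_prod_def lessThan_atLeast0)
  also have "\<dots> = (\<Sum>k<m. \<Sum>i<n. B $$ (k,i) * A $$ (i,k))"
    by (subst sum.swap) (simp add: mult.commute)
  also have "\<dots> = mat_trace (B * A)"
    using A B by (simp add: mat_trace_def scalar_prod_def lessThan_atLeast0)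
  finally show ?thesis .
qed

lemma mat_trace_conj:
  assumes Q: "Q \<in> carrier_mat n n" "real_unitary Q" and M: "M \<in> carrier_mat n n"
  shows "mat_trace (Q * M * Q\<^sup>T) = mat_trace M"
proof -
  have "mat_trace (Q * M * Q\<^sup>T) = mat_trace (Q\<^sup>T * (Q * M))"
    using Q M by (intro mat_trace_mult_commute[of _ n n]) auto
  also have "Q\<^sup>T * (Q * M) = (Q\<^sup>T * Q) * M"
    using Q M by (simp add: assoc_mult_mat[of _ n n _ n _ n]
      mult_carrier_mat[of _ n n _ n])
  finally show ?thesis using M by (simp add: real_unitaryD[OF Q(2,1)])
qed

lemma mat_trace_mat_diag: "mat_trace (mat_diag n d) = (\<Sum>i<n. d i)"
  by (simp add: mat_trace_def mat_diag_def)

lemma proots_prod_linear_factors: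
  "proots (\<Prod>a\<leftarrow>xs. [:- a, 1:]) = mset (xs :: 'a :: idom list)"
proof (induction xs)
  case (Cons a xs)
  have "(\<Prod>a\<leftarrow>xs. [:- a, 1:]) \<noteq> 0" by (auto simp: prod_list_zero_iff)
  then have "proots ([:- a, 1:] * (\<Prod>a\<leftarrow>xs. [:- a, 1:]))
      = proots [:- a, 1:] + proots (\<Prod>a\<leftarrow>xs. [:- a, 1:])"
    by (intro proots_mult) auto
  then show ?case using Cons by (simp del: mult_pCons_left)
qed simp

text \<open>
  Any orthogonal diagonalization of the Gram matrix exhibits the singular values, because similar
  matrices have the same characteristic polynomial. All computations of nuclear norms below go
  through this lemma.
\<close>
lemma nuclear_norm_of_gram:
  assumes Q: "Q \<in> carrier_mat n n" "real_unitary Q"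
    and gram: "M\<^sup>T * M = Q * mat_diag n d * Q\<^sup>T"
  shows "nuclear_norm M = (\<Sum>i<n. sqrt (d i))"
proof -
  have "similar_mat (M\<^sup>T * M) (mat_diag n d)"
    unfolding gram using Q real_unitaryD[OF Q(2,1)] by (intro similar_matI[of _ _ Q "Q\<^sup>T" n]) auto
  then have "char_poly (M\<^sup>T * M) = char_poly (mat_diag n d)"
    by (rule char_poly_similar)
  also have "\<dots> = (\<Prod>a\<leftarrow>diag_mat (mat_diag n d). [:- a, 1:])"
    by (rule char_poly_upper_triangular[of _ n]) (auto simp: mat_diag_def)
  finally have "proots (char_poly (M\<^sup>T * M)) = mset (diag_mat (mat_diag n d))"
    by (simp only: proots_prod_linear_factors)
  also have "diag_mat (mat_diag n d) = map d [0..<n]"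
    by (simp add: diag_mat_def mat_diag_def)
  finally have "singular_values M = mset (map (\<lambda>i. sqrt (d i)) [0..<n])"
    unfolding singular_values_def by (simp only: mset_map[symmetric] map_map o_def)
  then have "nuclear_norm M = (\<Sum>i\<leftarrow>[0..<n]. sqrt (d i))"
    unfolding nuclear_norm_def by (simp only: sum_mset_sum_list)
  then show ?thesis by (simp add: sum_list_distinct_conv_sum_set lessThan_atLeast0)
qed

lemma nuclear_norm_unitary_invariant:
  assumes M: "M \<in> carrier_mat n n"
    and U: "U \<in> carrier_mat n n" "real_unitary U" and V: "V \<in> carrier_mat n n" "real_unitary V"
  shows "nuclear_norm (U\<^sup>T * M * V) = nuclear_norm M"
proof -
  have "(U\<^sup>T * M * V)\<^sup>T * (U\<^sup>T * M * V) = V\<^sup>T * M\<^sup>T * (U * U\<^sup>T) * M * V"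
    using M U V by (simp add: transpose_mult[of _ n n _ n] assoc_mult_mat[of _ n n _ n _ n]
      mult_carrier_mat[of _ n n _ n])
  also have "\<dots> = V\<^sup>T * (M\<^sup>T * M) * V"
    using M U V real_unitaryD[OF U(2,1)] by (simp add: assoc_mult_mat[of _ n n _ n _ n]
      mult_carrier_mat[of _ n n _ n])
  finally have eq: "(U\<^sup>T * M * V)\<^sup>T * (U\<^sup>T * M * V) = V\<^sup>T * (M\<^sup>T * M) * V" .
  have "similar_mat ((U\<^sup>T * M * V)\<^sup>T * (U\<^sup>T * M * V)) (M\<^sup>T * M)"
    unfolding eq using M V real_unitaryD[OF V(2,1)]
    by (intro similar_matI[of _ _ "V\<^sup>T" V n]) auto
  then show ?thesis
    unfolding nuclear_norm_def singular_values_def by (simp add: char_poly_similar)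
qed

lemma sym_psd_conj_diag:
  assumes Q: "Q \<in> carrier_mat n n" and d: "\<And>i. i < n \<Longrightarrow> 0 \<le> d i"
  shows "sym_psd (Q * mat_diag n d * Q\<^sup>T)"
proof -
  have Dt: "(mat_diag n d)\<^sup>T = mat_diag n d"
    by (rule eq_matI) (auto simp: mat_diag_def)
  have "(Q * mat_diag n d * Q\<^sup>T)\<^sup>T = Q * mat_diag n d * Q\<^sup>T"
    using Q by (simp add: transpose_mult[of _ n n _ n] Dt assoc_mult_mat[of _ n n _ n _ n]
      mult_carrier_mat[of _ n n _ n])
  moreover have "0 \<le> x \<bullet> (Q * mat_diag n d * Q\<^sup>T *\<^sub>v x)" if x: "x \<in> carrier_vec n" for x
  proof -
    define y where "y = Q\<^sup>T *\<^sub>v x"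
    have y: "y \<in> carrier_vec n" using Q x by (simp add: y_def)
    have Dy: "mat_diag n d *\<^sub>v y = vec n (\<lambda>i. d i * y $ i)"
    proof (rule eq_vecI)
      fix i assume "i < dim_vec (vec n (\<lambda>i. d i * y $ i))"
      then have i: "i < n" by simp
      have "(mat_diag n d *\<^sub>v y) $ i = (\<Sum>j<n. (if i = j then d j else 0) * y $ j)"
        using i y by (simp add: mat_diag_def scalar_prod_def lessThan_atLeast0)
      also have "\<dots> = (\<Sum>j<n. if j = i then d i * y $ i else 0)"
        by (intro sum.cong) auto
      finally have "(mat_diag n d *\<^sub>v y) $ i = (\<Sum>j<n. if j = i then d i * y $ i else 0)" .
      then show "(mat_diag n d *\<^sub>v y) $ i = vec n (\<lambda>i. d i * y $ i) $ i" using i by simp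
    qed (simp add: mat_diag_def)
    have "x \<bullet> (Q * mat_diag n d * Q\<^sup>T *\<^sub>v x) = x \<bullet> (Q *\<^sub>v (mat_diag n d *\<^sub>v y))"
      unfolding y_def using Q x by (simp add: assoc_mult_mat_vec[of _ n n _ n] assoc_mult_mat[of _ n n _ n _ n]
      mult_carrier_mat[of _ n n _ n])
    also have "\<dots> = y \<bullet> (mat_diag n d *\<^sub>v y)"
      unfolding y_def by (rule transpose_vec_mult_scalar[OF Q _ x, symmetric])
        (use Q x in \<open>auto simp: mult_mat_vec_carrier[of _ n n]\<close>)
    also have "\<dots> = (\<Sum>i<n. d i * (y $ i)\<^sup>2)"
      unfolding Dy by (simp add: scalar_prod_def lessThan_atLeast0 power2_eq_square mult_ac)
    also have "\<dots> \<ge> 0" using d by (intro sum_nonneg) auto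
    finally show ?thesis .
  qed
  ultimately show ?thesis unfolding sym_psd_def using Q by auto
qed

lemma mult_mat_unit_vec:
  fixes M :: "'a :: semiring_1 mat"
  assumes "M \<in> carrier_mat nr n" and "i < n"
  shows "M *\<^sub>v unit_vec n i = col M i"
  using assms by (intro eq_vecI) (auto simp: scalar_prod_right_unit)

lemma col_orthonormal:
  assumes Q: "Q \<in> carrier_mat n n" "real_unitary Q" and i: "i < n"
  shows "col Q i \<bullet> col Q i = 1"
proof -
  have "(Q\<^sup>T * Q) $$ (i,i) = 1" using real_unitaryD[OF Q(2,1)] i by simp
  then show ?thesis using Q i by simp
qed

text \<open>
  For symmetric \<open>M = Q D Q\<^sup>T\<close> the Gram matrix is \<open>Q D\<^sup>2 Q\<^sup>T\<close>, so the singular values are the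
  absolute values of the eigenvalues. Positive semidefiniteness makes the absolute values
  disappear, and the eigenvalues sum to the trace.
\<close>
lemma nuclear_norm_eq_trace_if_sym_psd:
  assumes M: "M \<in> carrier_mat n n" and psd: "sym_psd M"
  shows "nuclear_norm M = mat_trace M"
proof -
  have sym: "M\<^sup>T = M" using psd by (simp add: sym_psd_def)
  obtain Q d where Q: "Q \<in> carrier_mat n n" "real_unitary Q"
    and Meq: "M = Q * mat_diag n d * Q\<^sup>T"
    using real_spectral_theorem[OF M sym] by auto
  note QQ = real_unitaryD[OF Q(2,1)]
  have "M\<^sup>T * M = Q * mat_diag n d * (Q\<^sup>T * Q) * mat_diag n d * Q\<^sup>T"
    unfolding sym using Q by (simp add: Meq assoc_mult_mat[of _ n n _ n _ n]
      mult_carrier_mat[of _ n n _ n])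
  also have "\<dots> = Q * mat_diag n (\<lambda>i. d i * d i) * Q\<^sup>T"
    using Q by (simp add: QQ left_mult_one_mat[of _ n n] assoc_mult_mat[of _ n n _ n _ n]
      mult_carrier_mat[of _ n n _ n] mat_diag_diag[symmetric]
        del: mat_diag_diag)
  finally have nn: "nuclear_norm M = (\<Sum>i<n. sqrt (d i * d i))"
    by (rule nuclear_norm_of_gram[OF Q])
  have "0 \<le> d i" if i: "i < n" for i
  proof -
    have MQ: "Q\<^sup>T * (M * Q) = mat_diag n d"
    proof -
      have "Q\<^sup>T * (M * Q) = (Q\<^sup>T * Q) * mat_diag n d * (Q\<^sup>T * Q)"
        unfolding Meq using Q by (simp add: assoc_mult_mat[of _ n n _ n _ n]
      mult_carrier_mat[of _ n n _ n])
      then show ?thesis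
        using QQ by (simp add: left_mult_one_mat[of _ n n] right_mult_one_mat[of _ n n])
    qed
    have "col Q i \<bullet> (M *\<^sub>v col Q i) = (Q\<^sup>T * (M * Q)) $$ (i,i)"
      using Q M i by (simp add: col_mult2[OF M Q(1) i, symmetric] del: col_mult2)
    also have "\<dots> = d i" unfolding MQ using i by (simp add: mat_diag_def)
    finally show ?thesis
      using psd M Q i unfolding sym_psd_def by (metis carrier_matD(1) col_carrier_vec carrier_matD(2))
  qed
  then have "nuclear_norm M = (\<Sum>i<n. d i)" unfolding nn by simp
  also have "\<dots> = mat_trace M"
    unfolding Meq using Q by (simp add: mat_trace_conj mat_trace_mat_diag)
  finally show ?thesis .
qed

text \<open>
  Let \<open>q\<^sub>i\<close> be an orthonormal eigenbasis of the Gram matrix of \<open>M\<close>, and let \<open>f\<^sub>i = M q\<^sub>i\<close>. The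
  length of \<open>f\<^sub>i\<close> is the singular value \<open>s\<^sub>i\<close>. The trace of \<open>M\<close> is the sum of all
  \<open>q\<^sub>i \<bullet> f\<^sub>i\<close>, and Cauchy--Schwarz bounds each summand by \<open>s\<^sub>i\<close>. If the sums of both sides agree,
  every single bound is attained, which forces \<open>f\<^sub>i = s\<^sub>i q\<^sub>i\<close>. So the \<open>q\<^sub>i\<close> are eigenvectors of
  \<open>M\<close> itself, with nonnegative eigenvalues \<open>s\<^sub>i\<close>.
\<close>
lemma sym_psd_if_nuclear_norm_eq_trace:
  assumes M: "M \<in> carrier_mat n n" and eq: "nuclear_norm M = mat_trace M"
  shows "sym_psd M"
proof -
  have MM: "M\<^sup>T * M \<in> carrier_mat n n" and "(M\<^sup>T * M)\<^sup>T = M\<^sup>T * M"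
    using M by (auto simp: transpose_mult[of _ n n _ n])
  from real_spectral_theorem[OF this] obtain Q d where Q: "Q \<in> carrier_mat n n" "real_unitary Q"
    and gram: "M\<^sup>T * M = Q * mat_diag n d * Q\<^sup>T" by auto
  note QQ = real_unitaryD[OF Q(2,1)]
  define F where "F = M * Q"
  have F: "F \<in> carrier_mat n n" using M Q by (simp add: F_def)
  define s where "s i = sqrt (d i)" for i
  have "F\<^sup>T * F = Q\<^sup>T * (M\<^sup>T * M) * Q"
    unfolding F_def using M Q by (simp add: transpose_mult[of _ n n _ n] assoc_mult_mat[of _ n n _ n _ n]
      mult_carrier_mat[of _ n n _ n])
  also have "\<dots> = (Q\<^sup>T * Q) * mat_diag n d * (Q\<^sup>T * Q)"
    unfolding gram using Q by (simp add: assoc_mult_mat[of _ n n _ n _ n]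
      mult_carrier_mat[of _ n n _ n])
  finally have FF: "F\<^sup>T * F = mat_diag n d"
    by (simp add: QQ left_mult_one_mat[of _ n n] right_mult_one_mat[of _ n n])
  have ff: "col F i \<bullet> col F i = d i" if i: "i < n" for i
    using arg_cong[OF FF, of "\<lambda>M. M $$ (i,i)"] F i by (simp add: mat_diag_def)
  have s: "0 \<le> s i" "s i * s i = d i" if "i < n" for i
    using ff[OF that] scalar_prod_self_nonneg[of "col F i"] by (auto simp: s_def)
  \<comment> \<open>This identity gives both Cauchy--Schwarz (its left side is nonnegative) and the equality case
    (its left side vanishes when the last factor does).\<close>
  have dist: "(col F i - s i \<cdot>\<^sub>v col Q i) \<bullet> (col F i - s i \<cdot>\<^sub>v col Q i)
      = 2 * s i * (s i - col Q i \<bullet> col F i)" if i: "i < n" for i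
  proof -
    have c: "col F i \<in> carrier_vec n" "col Q i \<in> carrier_vec n" using F Q i by auto
    show ?thesis
      using c ff[OF i] s[OF i] col_orthonormal[OF Q i] comm_scalar_prod[OF c]
      by (simp add: minus_scalar_prod_distrib[of _ n] scalar_prod_minus_distrib[of _ n]
          algebra_simps)
  qed
  have le: "col Q i \<bullet> col F i \<le> s i" if i: "i < n" for i
  proof (cases "s i = 0")
    case True
    then have "col F i = 0\<^sub>v n"
      using ff[OF i] s[OF i] scalar_prod_self_eq_0_iff[of "col F i" n] F i by simp
    then show ?thesis using True Q i by simp
  next
    case False
    with s[OF i] have "0 < s i" by simp
    with dist[OF i] scalar_prod_self_nonneg[of "col F i - s i \<cdot>\<^sub>v col Q i"]
    show ?thesis by (simp add: zero_le_mult_iff)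
  qed
  have "mat_trace M = mat_trace (Q\<^sup>T * F)"
  proof -
    have "mat_trace (Q\<^sup>T * F) = mat_trace (F * Q\<^sup>T)"
      using Q F by (intro mat_trace_mult_commute[of _ n n]) auto
    also have "F * Q\<^sup>T = M * (Q * Q\<^sup>T)"
      unfolding F_def using M Q by (simp add: assoc_mult_mat[of _ n n _ n _ n]
      mult_carrier_mat[of _ n n _ n])
    finally show ?thesis using M QQ by simp
  qed
  also have "\<dots> = (\<Sum>i<n. col Q i \<bullet> col F i)"
    using Q F by (simp add: mat_trace_def)
  finally have "(\<Sum>i<n. s i - col Q i \<bullet> col F i) = 0"
    using eq nuclear_norm_of_gram[OF Q gram] by (simp add: sum_subtractf s_def)
  then have tight: "s i - col Q i \<bullet> col F i = 0" if "i < n" for i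
    using that le by (subst (asm) sum_nonneg_eq_0_iff) auto
  have "col F i = s i \<cdot>\<^sub>v col Q i" if i: "i < n" for i
  proof -
    have "col F i - s i \<cdot>\<^sub>v col Q i = 0\<^sub>v n"
      using dist[OF i] tight[OF i] F Q i scalar_prod_self_eq_0_iff[of "col F i - s i \<cdot>\<^sub>v col Q i" n]
      by simp
    then have "(col F i - s i \<cdot>\<^sub>v col Q i) $ k = 0" if "k < n" for k using that by simp
    then show ?thesis using F Q i by (intro eq_vecI) auto
  qed
  then have entry: "F $$ (k,i) = Q $$ (k,i) * s i" if "k < n" "i < n" for k i
    using that F Q by (metis carrier_matD index_col index_smult_vec(1) dim_col mult.commute)
  have "F = Q * mat_diag n s"
    unfolding mat_diag_mult_right[OF Q(1)] using F by (intro eq_matI) (auto simp: entry)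
  moreover have "M = F * Q\<^sup>T"
    unfolding F_def using M Q QQ by (simp add: assoc_mult_mat[of _ n n _ n _ n]
      mult_carrier_mat[of _ n n _ n])
  ultimately show ?thesis
    using sym_psd_conj_diag[OF Q(1), of s] s by simp
qed

text \<open>
  On the vectors \<open>t e\<^sub>i + e\<^sub>j\<close> the quadratic form is \<open>2 t M\<^sub>i\<^sub>j + M\<^sub>j\<^sub>j\<close>. An affine function of \<open>t\<close>
  that is bounded below has slope zero.
\<close>
lemma sym_psd_zero_diag_imp_zero_row:
  assumes M: "M \<in> carrier_mat n n" and psd: "sym_psd M"
    and i: "i < n" and j: "j < n" and z: "M $$ (i,i) = 0"
  shows "M $$ (i,j) = 0"
proof (rule ccontr)
  assume nz: "M $$ (i,j) \<noteq> 0"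
  have sym: "M $$ (j,i) = M $$ (i,j)"
    using psd M i j unfolding sym_psd_def by (metis carrier_matD index_transpose_mat(1))
  \<comment> \<open>The parameter at which the affine function takes the value \<open>-1\<close>.\<close>
  define t where "t = - (M $$ (j,j) + 1) / (2 * M $$ (i,j))"
  define x where "x = t \<cdot>\<^sub>v unit_vec n i + unit_vec n j"
  have x: "x \<in> carrier_vec n" by (simp add: x_def)
  have Mx: "M *\<^sub>v x = t \<cdot>\<^sub>v col M i + col M j"
    unfolding x_def using M i j
    by (simp add: mult_add_distrib_mat_vec[of _ n n] mult_mat_vec[of _ n n] mult_mat_unit_vec)
  have "x \<bullet> (M *\<^sub>v x) = 2 * t * M $$ (i,j) + M $$ (j,j)"
    unfolding Mx unfolding x_def using M i j sym z
    by (simp add: add_scalar_prod_distrib[of _ n])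
  also have "\<dots> = -1" using nz by (simp add: t_def field_simps)
  finally show False using psd M x unfolding sym_psd_def by force
qed

section \<open>Completed singular bases\<close>

lemma append_cols_carrier:
  assumes "U \<in> carrier_mat a k" and "U' \<in> carrier_mat a l"
  shows "append_cols U U' \<in> carrier_mat a (k + l)"
  using assms unfolding append_cols_def by auto

lemma append_cols_mult_padded_vec:
  fixes U :: "'a :: comm_ring_1 mat"
  assumes U: "U \<in> carrier_mat a k" "U' \<in> carrier_mat a l" and y: "y \<in> carrier_vec k"
  shows "append_cols U U' *\<^sub>v (y @\<^sub>v 0\<^sub>v l) = U *\<^sub>v y"
  unfolding append_cols_def using U y
  by (subst four_block_mat_mult_vec[of _ a k _ l _ 0]) (auto intro!: eq_vecI)

lemma diag_block_mat_pair:
  assumes "P \<in> carrier_mat a k" and "R \<in> carrier_mat b l"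
  shows "diag_block_mat [P, R] = four_block_mat P (0\<^sub>m a l) (0\<^sub>m b k) R"
  by (simp only: diag_block_mat.simps(2)[of P "[R]"] diag_block_mat_singleton Let_def
      carrier_matD[OF assms(1)] carrier_matD[OF assms(2)])

lemma vec_padded:
  assumes "y \<in> carrier_vec (k + l)" and "\<And>i. k \<le> i \<Longrightarrow> i < k + l \<Longrightarrow> y $ i = 0"
  obtains x where "x \<in> carrier_vec k" and "y = x @\<^sub>v 0\<^sub>v l"
  using assms by (intro that[of "vec k (\<lambda>i. y $ i)"]) (auto intro!: eq_vecI)

text \<open>
  If the rows of \<open>G\<close> that meet the completing columns \<open>UA'\<close> and \<open>UD'\<close> vanish, then every product
  with \<open>G\<close> on the right is a combination of the columns of \<open>UA\<close> and \<open>UD\<close> only. Applied to a matrix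
  and to its transpose, this yields both subspace conditions of the theorem.
\<close>
lemma col_space_block_subset:
  fixes X :: "real mat"
  assumes UA: "UA \<in> carrier_mat a k" "UA' \<in> carrier_mat a k'" and a: "a = k + k'"
    and UD: "UD \<in> carrier_mat b l" "UD' \<in> carrier_mat b l'" and b: "b = l + l'"
    and G: "G \<in> carrier_mat (a + b) nc"
    and zero: "\<And>i j. j < nc \<Longrightarrow> k \<le> i \<and> i < a \<or> a + l \<le> i \<and> i < a + b \<Longrightarrow> G $$ (i,j) = 0"
    and X: "X = diag_block_mat [append_cols UA UA', append_cols UD UD'] * G"
  shows "vec_space.col_space (a + b) X \<subseteq> vec_space.col_space (a + b) (diag_block_mat [UA, UD])"
proof
  let ?FA = "append_cols UA UA'" and ?FD = "append_cols UD UD'"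
  let ?F = "diag_block_mat [?FA, ?FD]" and ?W = "diag_block_mat [UA, UD]"
  have FA: "?FA \<in> carrier_mat a a" and FD: "?FD \<in> carrier_mat b b"
    using append_cols_carrier[OF UA] append_cols_carrier[OF UD] a b by auto
  have F: "?F \<in> carrier_mat (a + b) (a + b)"
    unfolding diag_block_mat_pair[OF FA FD] using FA FD by auto
  have W: "?W \<in> carrier_mat (a + b) (k + l)"
    unfolding diag_block_mat_pair[OF UA(1) UD(1)] using UA UD by auto
  have Xc: "X \<in> carrier_mat (a + b) nc" unfolding X using F G by simp
  fix w assume "w \<in> vec_space.col_space (a + b) X"
  then obtain x where x: "x \<in> carrier_vec nc" and w: "w = X *\<^sub>v x"
    using vec_space.col_space_eq[OF Xc] Xc by auto
  define y where "y = G *\<^sub>v x"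
  have y: "y \<in> carrier_vec (a + b)" using G x by (simp add: y_def)
  have wy: "w = ?F *\<^sub>v y" unfolding w X y_def using F G x by (simp add: assoc_mult_mat_vec[of _ "a+b" "a+b" _ nc])
  have y0: "y $ i = 0" if "k \<le> i \<and> i < a \<or> a + l \<le> i \<and> i < a + b" for i
    using that zero G x by (auto simp: y_def scalar_prod_def intro!: sum.neutral)
  obtain p q where p: "p \<in> carrier_vec a" and q: "q \<in> carrier_vec b" and ypq: "y = p @\<^sub>v q"
    using y by (metis vec_first_carrier vec_last_carrier vec_first_last_append)
  obtain u where u: "u \<in> carrier_vec k" "p = u @\<^sub>v 0\<^sub>v k'"
  proof (rule vec_padded[of p k k'])
    fix i assume "k \<le> i" "i < k + k'"
    then show "p $ i = 0" using y0[of i] p q a by (simp add: ypq)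
  qed (use p a in auto)
  obtain v where v: "v \<in> carrier_vec l" "q = v @\<^sub>v 0\<^sub>v l'"
  proof (rule vec_padded[of q l l'])
    fix i assume "l \<le> i" "i < l + l'"
    then show "q $ i = 0" using y0[of "a + i"] p q b by (simp add: ypq)
  qed (use q b in auto)
  have "w = (?FA *\<^sub>v p) @\<^sub>v (?FD *\<^sub>v q)"
    unfolding wy ypq diag_block_mat_pair[OF FA FD] by (rule mult_mat_vec_split[OF FA FD p q])
  also have "\<dots> = (UA *\<^sub>v u) @\<^sub>v (UD *\<^sub>v v)"
    using UA UD u v by (simp add: append_cols_mult_padded_vec)
  also have "\<dots> = ?W *\<^sub>v (u @\<^sub>v v)"
    unfolding diag_block_mat_pair[OF UA(1) UD(1)]
    by (subst four_block_mat_mult_vec[OF UA(1) _ _ UD(1) u(1) v(1)]) (use UA UD u v in auto)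
  finally have "w = ?W *\<^sub>v (u @\<^sub>v v)" .
  moreover have "u @\<^sub>v v \<in> carrier_vec (k + l)" using u v by simp
  moreover from this have "?W *\<^sub>v (u @\<^sub>v v) \<in> carrier_vec (a + b)"
    by (rule mult_mat_vec_carrier[OF W])
  ultimately show "w \<in> vec_space.col_space (a + b) ?W"
    unfolding vec_space.col_space_eq[OF W] carrier_matD[OF W] by blast
qed

text \<open>
  In the completed bases the matrix \<open>A\<close> becomes \<open>S L S\<^sup>T\<close>, where \<open>S\<close> consists of the leading columns
  of the identity: multiplying a completed basis by \<open>S\<close> selects the original singular vectors. The
  dimension facts are part of the conclusion since the two bases have the same number of columns,
  the rank of \<open>A\<close>.
\<close>
lemma completed_svd_diagonalizes:
  assumes A: "A \<in> carrier_mat a a" and svd: "compact_svd A U L V"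
    and U': "U' \<in> carrier_mat a (a - dim_col U)" "real_unitary (append_cols U U')"
    and V': "V' \<in> carrier_mat a (a - dim_col V)" "real_unitary (append_cols V V')"
  obtains p where "dim_col U \<le> a" and "dim_col V = dim_col U"
    and "U \<in> carrier_mat a (dim_col U)" and "V \<in> carrier_mat a (dim_col U)"
    and "(append_cols U U')\<^sup>T * A * append_cols V V' = mat_diag a p"
    and "\<And>i. 0 \<le> p i" and "\<And>i. dim_col U \<le> i \<Longrightarrow> p i = 0"
proof -
  define r where "r = vec_space.rank (dim_row A) A"
  define k where "k = dim_col U"
  from svd have Ur: "U \<in> carrier_mat (dim_row A) r" and Vr: "V \<in> carrier_mat (dim_col A) r"
    and Lr: "L \<in> carrier_mat r r" and diag: "diagonal_mat L"
    and mL: "mset (diag_mat L) = filter_mset (\<lambda>s. 0 < s) (singular_values A)"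
    and Aeq: "A = U * L * V\<^sup>T"
    unfolding compact_svd_def Let_def r_def by blast+
  have "r = k" using Ur by (simp add: k_def)
  with Ur Vr Lr have U: "U \<in> carrier_mat a k" and V: "V \<in> carrier_mat a k"
    and L: "L \<in> carrier_mat k k"
    unfolding carrier_matD[OF A] by auto
  have dV: "dim_col V = k" and dU: "dim_col U = k" using V k_def by auto
  let ?F = "append_cols U U'" and ?G = "append_cols V V'"
  have "?F \<in> carrier_mat a (k + (a - k))"
    using append_cols_carrier[OF U] U' by (simp add: dU)
  moreover have "square_mat ?F" using U' by (simp add: real_unitary_def)
  ultimately have ka: "k \<le> a" by auto
  have F: "?F \<in> carrier_mat a a" and G: "?G \<in> carrier_mat a a"
    using append_cols_carrier[OF U, of U' "a - k"] U' append_cols_carrier[OF V, of V' "a - k"] V' ka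
    by (auto simp: dU dV)
  define S where "S = mat a k (\<lambda>(i,j). if i = j then 1 else (0::real))"
  have S: "S \<in> carrier_mat a k" by (simp add: S_def)
  have sel: "append_cols P P' * S = P" if "P \<in> carrier_mat a k" "P' \<in> carrier_mat a (a - k)" for P P'
  proof (rule eq_matI)
    fix i j assume "i < dim_row P" "j < dim_col P"
    then have ij: "i < a" "j < k" using that by auto
    have "(append_cols P P' * S) $$ (i,j)
        = (\<Sum>t<a. append_cols P P' $$ (i,t) * (if t = j then 1 else 0))"
      using append_cols_carrier[OF that] ka ij
      by (simp add: S_def scalar_prod_def lessThan_atLeast0)
    also have "\<dots> = (\<Sum>t<a. if t = j then append_cols P P' $$ (i,t) else 0)"
      by (intro sum.cong) auto
    also have "\<dots> = P $$ (i,j)" using ij ka that by (simp add: append_cols_def)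
    finally show "(append_cols P P' * S) $$ (i,j) = P $$ (i,j)" .
  qed (use that in \<open>auto simp: S_def append_cols_def\<close>)
  have FS: "?F * S = U" and GS: "?G * S = V"
    using sel U V U' V' by (auto simp: dU dV)
  define l where "l i = L $$ (i,i)" for i
  have Ll: "L = mat_diag k l"
    using L diag by (intro eq_matI) (auto simp: mat_diag_def l_def diagonal_mat_def)
  have lpos: "0 \<le> l i" if "i < k" for i
  proof -
    have "l i \<in># mset (diag_mat L)" using that L by (auto simp: diag_mat_def l_def)
    then show ?thesis unfolding mL by simp
  qed
  define p where "p i = (if i < k then l i else 0)" for i
  have SLS: "S * L * S\<^sup>T = mat_diag a p"
  proof (rule eq_matI)
    fix i j assume "i < dim_row (mat_diag a p)" "j < dim_col (mat_diag a p)"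
    then have ij: "i < a" "j < a" by (auto simp: mat_diag_def)
    have "(S * L * S\<^sup>T) $$ (i,j) = (\<Sum>t<k. S $$ (i,t) * l t * S $$ (j,t))"
      unfolding Ll mat_diag_mult_right[OF S] using ij S
      by (simp add: scalar_prod_def lessThan_atLeast0)
    also have "\<dots> = (\<Sum>t<k. if t = i then (if i = j then l i else 0) else 0)"
      using ij by (intro sum.cong) (auto simp: S_def)
    also have "\<dots> = mat_diag a p $$ (i,j)" using ij by (simp add: mat_diag_def p_def)
    finally show "(S * L * S\<^sup>T) $$ (i,j) = mat_diag a p $$ (i,j)" .
  qed (use S in \<open>auto simp: mat_diag_def\<close>)
  have "A = ?F * (S * L * S\<^sup>T) * ?G\<^sup>T"
  proof -
    have St: "S\<^sup>T \<in> carrier_mat k a" and Gt: "?G\<^sup>T \<in> carrier_mat a a" using S G by auto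
    note SL = mult_carrier_mat[OF S L] and StG = mult_carrier_mat[OF St Gt]
    have "A = (?F * S) * L * (?G * S)\<^sup>T" using Aeq FS GS by simp
    also have "\<dots> = (?F * S) * L * (S\<^sup>T * ?G\<^sup>T)" using G S by (simp add: transpose_mult)
    also have "\<dots> = ?F * (S * L) * (S\<^sup>T * ?G\<^sup>T)"
      by (simp only: assoc_mult_mat[OF F S L])
    also have "\<dots> = ?F * (S * L * (S\<^sup>T * ?G\<^sup>T))"
      by (rule assoc_mult_mat[OF F SL StG])
    also have "S * L * (S\<^sup>T * ?G\<^sup>T) = S * L * S\<^sup>T * ?G\<^sup>T"
      by (rule assoc_mult_mat[OF SL St Gt, symmetric])
    also have "?F * \<dots> = ?F * (S * L * S\<^sup>T) * ?G\<^sup>T"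
      by (rule assoc_mult_mat[OF F mult_carrier_mat[OF SL St] Gt, symmetric])
    finally show ?thesis .
  qed
  then have "?F\<^sup>T * A * ?G = (?F\<^sup>T * ?F) * mat_diag a p * (?G\<^sup>T * ?G)"
    unfolding SLS using F G by (simp add: assoc_mult_mat[of _ a a _ a _ a]
      mult_carrier_mat[of _ a a _ a])
  also have "\<dots> = mat_diag a p"
    using real_unitaryD[OF U'(2) F] real_unitaryD[OF V'(2) G]
    by (simp add: left_mult_one_mat[of _ a a] right_mult_one_mat[of _ a a])
  finally have "?F\<^sup>T * A * ?G = mat_diag a p" .
  then show ?thesis
    using that[of p] ka dV U V lpos unfolding k_def[symmetric] by (auto simp: p_def)
qed

section \<open>The equality case for block matrices\<close>

text \<open>
  The completed bases turn the block diagonal of \<open>X\<close> into \<open>mat_diag n r\<close>, where \<open>r\<close> lists the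
  singular values of \<open>A\<close> and of \<open>D\<close>, each list padded with zeros. Since \<open>r\<close> is also the diagonal
  of \<open>E\<close>, the equality of nuclear norms says that the nuclear norm of \<open>E\<close> is its trace.
\<close>
theorem lemma3p3:
  fixes n m :: nat
    and A B C D X E U\<^sub>A \<Lambda>\<^sub>A V\<^sub>A U\<^sub>D \<Lambda>\<^sub>D V\<^sub>D U\<^sub>A' V\<^sub>A' U\<^sub>D' V\<^sub>D' :: "real mat"
  assumes "m \<le> n"
    and "A \<in> carrier_mat m m" and "B \<in> carrier_mat m (n - m)"
    and "C \<in> carrier_mat (n - m) m" and "D \<in> carrier_mat (n - m) (n - m)"
    and "X = four_block_mat A B C D"
    and "compact_svd A U\<^sub>A \<Lambda>\<^sub>A V\<^sub>A"
    and "compact_svd D U\<^sub>D \<Lambda>\<^sub>D V\<^sub>D"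
    and "U\<^sub>A' \<in> carrier_mat m (m - dim_col U\<^sub>A)" and "real_unitary (append_cols U\<^sub>A U\<^sub>A')"
    and "V\<^sub>A' \<in> carrier_mat m (m - dim_col V\<^sub>A)" and "real_unitary (append_cols V\<^sub>A V\<^sub>A')"
    and "U\<^sub>D' \<in> carrier_mat (n - m) (n - m - dim_col U\<^sub>D)"
    and "real_unitary (append_cols U\<^sub>D U\<^sub>D')"
    and "V\<^sub>D' \<in> carrier_mat (n - m) (n - m - dim_col V\<^sub>D)"
    and "real_unitary (append_cols V\<^sub>D V\<^sub>D')"
    and "E = (diag_block_mat [append_cols U\<^sub>A U\<^sub>A', append_cols U\<^sub>D U\<^sub>D'])\<^sup>T * X *
             diag_block_mat [append_cols V\<^sub>A V\<^sub>A', append_cols V\<^sub>D V\<^sub>D']"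
  shows "nuclear_norm X = nuclear_norm (diag_block_mat [A, D]) \<longleftrightarrow>
    vec_space.row_space n X \<subseteq> vec_space.row_space n ((diag_block_mat [V\<^sub>A, V\<^sub>D])\<^sup>T) \<and>
    vec_space.col_space n X \<subseteq> vec_space.col_space n (diag_block_mat [U\<^sub>A, U\<^sub>D]) \<and>
    sym_psd E"
proof -
  define b where "b = n - m"
  have n: "n = m + b" using \<open>m \<le> n\<close> by (simp add: b_def)
  have A: "A \<in> carrier_mat m m" and B: "B \<in> carrier_mat m b" and C: "C \<in> carrier_mat b m"
    and D: "D \<in> carrier_mat b b"
    using assms(2-5) by (simp_all add: b_def)
  define k where "k = dim_col U\<^sub>A"
  define l where "l = dim_col U\<^sub>D"
  let ?FA = "append_cols U\<^sub>A U\<^sub>A'" and ?GA = "append_cols V\<^sub>A V\<^sub>A'"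
  let ?FD = "append_cols U\<^sub>D U\<^sub>D'" and ?GD = "append_cols V\<^sub>D V\<^sub>D'"
  obtain p where ka: "k \<le> m" and VAk: "dim_col V\<^sub>A = k"
    and UA: "U\<^sub>A \<in> carrier_mat m k" and VA: "V\<^sub>A \<in> carrier_mat m k"
    and PA: "?FA\<^sup>T * A * ?GA = mat_diag m p"
    and p: "\<And>i. 0 \<le> p i" "\<And>i. k \<le> i \<Longrightarrow> p i = 0"
    using completed_svd_diagonalizes[OF A assms(7) assms(9) assms(10) assms(11) assms(12)]
    unfolding k_def by metis
  obtain q where lb: "l \<le> b" and VDl: "dim_col V\<^sub>D = l"
    and UD: "U\<^sub>D \<in> carrier_mat b l" and VD: "V\<^sub>D \<in> carrier_mat b l"
    and PD: "?FD\<^sup>T * D * ?GD = mat_diag b q"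
    and q: "\<And>i. 0 \<le> q i" "\<And>i. l \<le> i \<Longrightarrow> q i = 0"
    using completed_svd_diagonalizes[OF assms(5) assms(8) assms(13) assms(14) assms(15) assms(16)]
    unfolding l_def b_def by metis
  have UA': "U\<^sub>A' \<in> carrier_mat m (m - k)" and VA': "V\<^sub>A' \<in> carrier_mat m (m - k)"
    using assms(9,11) VAk by (simp_all add: k_def)
  have UD': "U\<^sub>D' \<in> carrier_mat b (b - l)" and VD': "V\<^sub>D' \<in> carrier_mat b (b - l)"
    using assms(13,15) VDl by (simp_all add: l_def b_def)
  have FA: "?FA \<in> carrier_mat m m" and GA: "?GA \<in> carrier_mat m m"
    using append_cols_carrier[OF UA UA'] append_cols_carrier[OF VA VA'] ka by simp_all
  have FD: "?FD \<in> carrier_mat b b" and GD: "?GD \<in> carrier_mat b b"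
    using append_cols_carrier[OF UD UD'] append_cols_carrier[OF VD VD'] lb by simp_all
  have FAt: "?FA\<^sup>T \<in> carrier_mat m m" and FDt: "?FD\<^sup>T \<in> carrier_mat b b" using FA FD by auto

  define U where "U = diag_block_mat [?FA, ?FD]"
  define V where "V = diag_block_mat [?GA, ?GD]"
  have Ublk: "U = four_block_mat ?FA (0\<^sub>m m b) (0\<^sub>m b m) ?FD"
    and Vblk: "V = four_block_mat ?GA (0\<^sub>m m b) (0\<^sub>m b m) ?GD"
    unfolding U_def V_def by (rule diag_block_mat_pair[OF FA FD], rule diag_block_mat_pair[OF GA GD])
  have U: "U \<in> carrier_mat n n" "real_unitary U"
    unfolding Ublk n using FA FD assms(10,14) by (auto intro: real_unitary_block_diag)
  have V: "V \<in> carrier_mat n n" "real_unitary V"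
    unfolding Vblk n using GA GD assms(12,16) by (auto intro: real_unitary_block_diag)
  note UU = real_unitaryD[OF U(2,1)] and VV = real_unitaryD[OF V(2,1)]
  have X: "X \<in> carrier_mat n n" unfolding assms(6) n using A D by auto
  have Eeq: "E = U\<^sup>T * X * V" unfolding U_def V_def by (rule assms(17))
  have E: "E \<in> carrier_mat n n" unfolding Eeq using U V X by auto
  have AD: "diag_block_mat [A, D] = four_block_mat A (0\<^sub>m m b) (0\<^sub>m b m) D"
    by (rule diag_block_mat_pair[OF A D])
  have ADc: "diag_block_mat [A, D] \<in> carrier_mat n n" unfolding AD n using A D by auto
  have Ut: "U\<^sup>T = four_block_mat (?FA\<^sup>T) (0\<^sub>m m b) (0\<^sub>m b m) (?FD\<^sup>T)"
    unfolding Ublk by (rule transpose_block_diag[OF FA FD])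

  define r where "r i = (if i < m then p i else q (i - m))" for i
  have r_nonneg: "0 \<le> r i" for i using p q by (simp add: r_def)
  have r_zero: "r i = 0" if "k \<le> i \<and> i < m \<or> m + l \<le> i \<and> i < m + b" for i
    using that p q by (auto simp: r_def)
  have diagAD: "U\<^sup>T * diag_block_mat [A, D] * V = mat_diag n r"
  proof -
    show ?thesis
      unfolding Ut AD Vblk mult_block_diag[OF FAt A FDt D]
        mult_block_diag[OF mult_carrier_mat[OF FAt A] GA mult_carrier_mat[OF FDt D] GD]
        PA PD mat_diag_block_diag n r_def ..
  qed
  have "nuclear_norm (diag_block_mat [A, D]) = nuclear_norm (mat_diag n r)"
    using nuclear_norm_unitary_invariant[OF ADc U V] diagAD by simp
  also have "\<dots> = mat_trace (mat_diag n r)"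
    using sym_psd_conj_diag[of "1\<^sub>m n" n r] r_nonneg
    by (intro nuclear_norm_eq_trace_if_sym_psd[of _ n])
      (simp_all add: left_mult_one_mat[of _ n n] right_mult_one_mat[of _ n n])
  finally have nAD: "nuclear_norm (diag_block_mat [A, D]) = (\<Sum>i<n. r i)"
    by (simp add: mat_trace_mat_diag)

  have E_diag: "E $$ (i,i) = r i" if i: "i < n" for i
  proof -
    have 1: "U\<^sup>T * X = four_block_mat (?FA\<^sup>T * A) (?FA\<^sup>T * B) (?FD\<^sup>T * C) (?FD\<^sup>T * D)"
      unfolding Ut assms(6) using FAt FDt A B C D
      by (subst mult_four_block_mat[of _ m m _ b _ b _ _ m _ b])
        (auto simp: left_mult_zero_mat[of _ b] left_mult_zero_mat[of _ m]
          mult_carrier_mat[of _ m m] mult_carrier_mat[of _ b b])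
    have "E = four_block_mat (?FA\<^sup>T * A * ?GA) (?FA\<^sup>T * B * ?GD)
        (?FD\<^sup>T * C * ?GA) (?FD\<^sup>T * D * ?GD)"
      unfolding Eeq 1 unfolding Vblk
      by (subst mult_four_block_mat[OF mult_carrier_mat[OF FAt A] mult_carrier_mat[OF FAt B]
            mult_carrier_mat[OF FDt C] mult_carrier_mat[OF FDt D] GA _ _ GD])
        (use FAt FDt A B C D GA GD in \<open>auto simp: right_mult_zero_mat[of _ _ b]
          right_mult_zero_mat[of _ _ m] mult_carrier_mat[of _ m m] mult_carrier_mat[of _ b b]
          mult_carrier_mat[of _ m b] mult_carrier_mat[of _ b m]\<close>)
    then show ?thesis using i by (auto simp: PA PD r_def mat_diag_def n)
  qed
  have "nuclear_norm X = nuclear_norm E"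
    unfolding Eeq by (rule nuclear_norm_unitary_invariant[OF X U V, symmetric])
  moreover have "mat_trace E = (\<Sum>i<n. r i)"
    unfolding mat_trace_def using E by (simp add: E_diag)
  ultimately have equiv: "nuclear_norm X = nuclear_norm (diag_block_mat [A, D]) \<longleftrightarrow> sym_psd E"
    using nAD nuclear_norm_eq_trace_if_sym_psd[OF E] sym_psd_if_nuclear_norm_eq_trace[OF E] by auto

  have spaces: "vec_space.row_space n X \<subseteq> vec_space.row_space n ((diag_block_mat [V\<^sub>A, V\<^sub>D])\<^sup>T)
      \<and> vec_space.col_space n X \<subseteq> vec_space.col_space n (diag_block_mat [U\<^sub>A, U\<^sub>D])"
    if psd: "sym_psd E"
  proof -
    have Et: "E\<^sup>T = E" using psd by (simp add: sym_psd_def)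
    \<comment> \<open>The diagonal entries of \<open>E\<close> at the completing indices are zero, so these rows of \<open>E\<close> vanish.\<close>
    have zero: "(E * M) $$ (i,j) = 0"
      if M: "M \<in> carrier_mat n n" and j: "j < n"
        and i: "k \<le> i \<and> i < m \<or> m + l \<le> i \<and> i < m + b" for M i j
    proof -
      have "i < n" using i n by auto
      then have "E $$ (i,t) = 0" if "t < n" for t
        using sym_psd_zero_diag_imp_zero_row[OF E psd _ that] E_diag r_zero[OF i] by simp
      then show ?thesis using E M \<open>i < n\<close> j by (simp add: scalar_prod_def)
    qed
    have Xeq: "X = U * (E * V\<^sup>T)"
    proof -
      have "U * (E * V\<^sup>T) = (U * U\<^sup>T) * X * (V * V\<^sup>T)"
        unfolding Eeq using U V X
        by (simp add: assoc_mult_mat[of _ n n _ n _ n] mult_carrier_mat[of _ n n _ n])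
      then show ?thesis
        using X UU VV by (simp add: left_mult_one_mat[of _ n n] right_mult_one_mat[of _ n n])
    qed
    have Xteq: "X\<^sup>T = V * (E * U\<^sup>T)"
    proof -
      have "X\<^sup>T = (E * V\<^sup>T)\<^sup>T * U\<^sup>T"
        unfolding Xeq using U V E
        by (simp add: transpose_mult[of _ n n _ n] mult_carrier_mat[of _ n n _ n])
      also have "\<dots> = V * (E * U\<^sup>T)"
        using U V E by (simp add: transpose_mult[of _ n n _ n] mult_carrier_mat[of _ n n _ n]
            assoc_mult_mat[of _ n n _ n _ n] Et)
      finally show ?thesis .
    qed
    have EV: "E * V\<^sup>T \<in> carrier_mat n n" and EU: "E * U\<^sup>T \<in> carrier_mat n n"
      and Vt: "V\<^sup>T \<in> carrier_mat n n" and Utc: "U\<^sup>T \<in> carrier_mat n n"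
      using E U V by auto
    have "vec_space.col_space n X \<subseteq> vec_space.col_space n (diag_block_mat [U\<^sub>A, U\<^sub>D])"
      using col_space_block_subset[OF UA UA' _ UD UD' _ EV[unfolded n] zero[OF Vt, unfolded n]
          Xeq[unfolded U_def]] ka lb n by simp
    moreover have "vec_space.col_space n (X\<^sup>T) \<subseteq> vec_space.col_space n (diag_block_mat [V\<^sub>A, V\<^sub>D])"
      using col_space_block_subset[OF VA VA' _ VD VD' _ EU[unfolded n] zero[OF Utc, unfolded n]
          Xteq[unfolded V_def]] ka lb n by simp
    ultimately show ?thesis
      unfolding vec_space.row_space_eq_col_space_transpose transpose_transpose by simp
  qed
  show ?thesis using equiv spaces by blast
qed

end
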